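(* Let $H$ be a finite simple undirected graph with at least one edge such that $\mathrm{im}(H)=\mathrm{m}(H)$, that is, the maximum size of an induced matching of $H$ equals the maximum size of a matching of $H$. Then the matching complex of $H$ is vertex decomposable.
   Context: All graphs are finite, simple and undirected. An induced matching of $H$ is a matching $M$ of $H$ such that for every pair of edges $e\neq e'$ in $M$ there is no edge $f$ of $H$ that is incident to an endpoint of $e$ and to an endpoint of $e'$. $\mathrm{im}(H)$ denotes the maximum size of an induced matching of $H$ and $\mathrm{m}(H)$ the maximum size of a matching of $H$. The matching complex of $H$ is the simplicial complex on the vertex set $\mathrm{E}(H)$ whose faces are the matchings of $H$ (including the empty matching). For a face $F$ of a simplicial complex $\Gamma$, $\mathrm{link}_\Gamma(F)=\{A\setminus F : F\subseteq A\in\Gamma\}$, and for a vertex $v$, $\mathrm{link}_\Gamma(v)=\mathrm{link}_\Gamma(\{v\})$ and $\Gamma-v=\{F\in\Gamma : v\notin F\}$. A vertex $v$ of a nonempty simplicial complex $\Gamma$ is a shedding vertex if no face of $\mathrm{link}_\Gamma(v)$ is a facet of $\Gamma-v$. A nonempty simplicial complex $\Gamma$ is vertex decomposable if either it is a simplex (the complex $\{\emptyset\}$ counts as a simplex) or there is a shedding vertex $v$ such that both $\mathrm{link}_\Gamma(v)$ and $\Gamma-v$ are vertex decomposable (recursively). *)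

theory Defs
  imports Main "HOL-Library.Ramsey"
begin

text \<open>A graph is given by its vertex set \<open>V\<close> and its set \<open>E\<close> of edges, an edge being a
  two-element subset of \<open>V\<close>.\<close>

definition finite_simple_graph :: "'v set \<Rightarrow> 'v set set \<Rightarrow> bool" where
  "finite_simple_graph V E \<longleftrightarrow> finite V \<and> E \<subseteq> nsets V 2"

definition matching :: "'v set set \<Rightarrow> 'v set set \<Rightarrow> bool" where
  "matching E M \<longleftrightarrow> M \<subseteq> E \<and> pairwise disjnt M"

definition induced_matching :: "'v set set \<Rightarrow> 'v set set \<Rightarrow> bool" where
  "induced_matching E M \<longleftrightarrow> matching E M \<and>
     (\<forall>e\<in>M. \<forall>e'\<in>M. e \<noteq> e' \<longrightarrow> \<not> (\<exists>f\<in>E. f \<inter> e \<noteq> {} \<and> f \<inter> e' \<noteq> {}))"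

definition matching_number :: "'v set set \<Rightarrow> nat" where
  "matching_number E = Max (card ` {M. matching E M})"

definition induced_matching_number :: "'v set set \<Rightarrow> nat" where
  "induced_matching_number E = Max (card ` {M. induced_matching E M})"

text \<open>A simplicial complex is identified with its set of faces.  A nonempty one contains \<open>{}\<close>;
  the complex without faces is allowed here and excluded where necessary.\<close>

definition simplicial_complex :: "'a set set \<Rightarrow> bool" where
  "simplicial_complex \<Gamma> \<longleftrightarrow> finite \<Gamma> \<and> (\<forall>A\<in>\<Gamma>. finite A \<and> (\<forall>B. B \<subseteq> A \<longrightarrow> B \<in> \<Gamma>))"

definition facet :: "'a set set \<Rightarrow> 'a set \<Rightarrow> bool" where
  "facet \<Gamma> F \<longleftrightarrow> F \<in> \<Gamma> \<and> (\<forall>A\<in>\<Gamma>. F \<subseteq> A \<longrightarrow> A = F)"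

definition link :: "'a set set \<Rightarrow> 'a set \<Rightarrow> 'a set set" where
  "link \<Gamma> F = {A - F |A. F \<subseteq> A \<and> A \<in> \<Gamma>}"

definition deletion :: "'a set set \<Rightarrow> 'a \<Rightarrow> 'a set set" where
  "deletion \<Gamma> v = {F \<in> \<Gamma>. v \<notin> F}"

definition shedding_vertex :: "'a set set \<Rightarrow> 'a \<Rightarrow> bool" where
  "shedding_vertex \<Gamma> v \<longleftrightarrow> {v} \<in> \<Gamma> \<and> \<not> (\<exists>F\<in>link \<Gamma> {v}. facet (deletion \<Gamma> v) F)"

text \<open>The link and the deletion of a vertex of a finite complex have strictly fewer faces than the
  complex, so the least predicate closed under the two rules is the recursively defined one.  The
  simplices are the complexes \<open>Pow F\<close> with \<open>F\<close> finite; \<open>F = {}\<close> gives the complex \<open>{{}}\<close>.\<close>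

inductive vertex_decomposable :: "'a set set \<Rightarrow> bool" where
  simplex: "finite F \<Longrightarrow> vertex_decomposable (Pow F)"
| shed: "\<lbrakk>simplicial_complex \<Gamma>; \<Gamma> \<noteq> {}; shedding_vertex \<Gamma> v;
          vertex_decomposable (link \<Gamma> {v}); vertex_decomposable (deletion \<Gamma> v)\<rbrakk>
         \<Longrightarrow> vertex_decomposable \<Gamma>"

definition matching_complex :: "'v set set \<Rightarrow> 'v set set set" where
  "matching_complex E = {M. matching E M}"

end

(* The line graph of H is partitioned into cliques: if M is an induced matching of H of size m(H),
   then every edge of H meets exactly one edge of M, and two edges meeting the same f in M meet
   each other, since otherwise they could replace f and enlarge M.  An edge e outside M that meets
   f in M is then shedding, because f extends every matching that avoids the endpoints of e.  Both
   the link and the deletion of e are matching complexes of graphs with such a clique partition. *)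
theory Submission
  imports Defs
begin

lemma matching_subset: "matching E M \<Longrightarrow> N \<subseteq> M \<Longrightarrow> matching E N"
  by (meson matching_def pairwise_subset subset_trans)

lemma matching_insert:
  "matching E (insert e M) \<longleftrightarrow> e \<in> E \<and> matching E M \<and> (\<forall>g\<in>M. g \<noteq> e \<longrightarrow> disjnt g e)"
  unfolding matching_def pairwise_insert using disjnt_sym by blast

lemma finite_matchings: "finite E \<Longrightarrow> finite {M. matching E M}"
  by (rule finite_subset[of _ "Pow E"]) (auto simp: matching_def)

lemma simplicial_complex_matching_complex:
  assumes "finite E"
  shows "simplicial_complex (matching_complex E)"
  using assms finite_matchings[OF assms]
  by (auto simp: simplicial_complex_def matching_complex_def matching_def
      intro: finite_subset pairwise_subset)

lemma deletion_matching_complex: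
  "deletion (matching_complex E) e = matching_complex (E - {e})"
  by (auto simp: deletion_def matching_complex_def matching_def)

text \<open>A matching through \<open>e\<close> is \<open>e\<close> together with a matching among
  the edges that avoid \<open>e\<close>. Since \<open>e\<close> is nonempty it meets itself, so it
  does not occur on the right-hand side, just as it is removed from every face of the link.\<close>

lemma link_matching_complex:
  assumes "e \<in> E" "e \<noteq> {}"
  shows "link (matching_complex E) {e} = matching_complex {g \<in> E. disjnt g e}"
proof (intro equalityI subsetI)
  fix F assume "F \<in> link (matching_complex E) {e}"
  then obtain A where A: "F = A - {e}" "e \<in> A" "matching E A"
    by (auto simp: link_def matching_complex_def)
  then show "F \<in> matching_complex {g \<in> E. disjnt g e}"
    by (auto simp: matching_complex_def matching_def pairwise_def)
next
  fix F assume F: "F \<in> matching_complex {g \<in> E. disjnt g e}"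
  then have "e \<notin> F"
    using assms(2) by (auto simp: matching_complex_def matching_def)
  moreover have "matching E (insert e F)"
    unfolding matching_insert using F assms(1)
    by (auto simp: matching_complex_def matching_def)
  ultimately show "F \<in> link (matching_complex E) {e}"
    unfolding link_def matching_complex_def by (intro CollectI exI[of _ "insert e F"]) auto
qed

text \<open>The hypotheses are chosen to survive the induction on \<open>card E\<close>: the
  deletion of an edge outside \<open>M\<close> keeps \<open>M\<close>, while the link of
  \<open>e\<close> keeps only the members of \<open>M\<close> disjoint from \<open>e\<close>. Hence
  \<open>M\<close> varies along with \<open>E\<close>.\<close>

lemma vertex_decomposable_clique_partition:
  assumes "finite E" "{} \<notin> E" "matching E M"
    and "\<And>e. e \<in> E \<Longrightarrow> \<exists>f\<in>M. \<not> disjnt e f"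
    and "\<And>f e g. \<lbrakk>f \<in> M; e \<in> E; g \<in> E; \<not> disjnt e f; \<not> disjnt g f\<rbrakk> \<Longrightarrow> \<not> disjnt e g"
  shows "vertex_decomposable (matching_complex E)"
  using assms
proof (induction "card E" arbitrary: E M rule: less_induct)
  case less
  note ne = less.prems(2) and M = less.prems(3) and cover = less.prems(4)
    and clique = less.prems(5)
  show ?case
  proof (cases "E \<subseteq> M")
    case True
    \<comment> \<open>Here \<open>E\<close> is itself a matching, so the complex is a
      simplex.\<close>
    then have "matching_complex E = Pow E"
      using M by (auto simp: matching_complex_def matching_def intro: pairwise_subset)
    then show ?thesis
      using less.prems(1) vertex_decomposable.simplex by metis
  next
    case False
    then obtain e where e: "e \<in> E" "e \<notin> M" by blast
    obtain f where f: "f \<in> M" "\<not> disjnt e f" using cover[OF e(1)] by blast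
    have e0: "e \<noteq> {}" using e ne by auto
    let ?D = "E - {e}" and ?L = "{g \<in> E. disjnt g e}"
    have "e \<notin> ?L" using e0 by simp
    then have "card ?L < card E"
      using e(1) less.prems(1) by (intro psubset_card_mono) blast+
    moreover have "matching ?L {f' \<in> M. disjnt f' e}"
      using M by (auto simp: matching_def pairwise_def)
    \<comment> \<open>The member of \<open>M\<close> that \<open>g\<close> meets survives in the
      link: if it also met \<open>e\<close>, the clique property would make \<open>g\<close> meet
      \<open>e\<close>.\<close>
    moreover have "\<exists>f'\<in>{f' \<in> M. disjnt f' e}. \<not> disjnt g f'" if g: "g \<in> ?L" for g
    proof -
      obtain f' where f': "f' \<in> M" "\<not> disjnt g f'" using cover g by blast
      then have "disjnt f' e" using clique[of f' e g] e(1) g disjnt_sym by blast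
      then show ?thesis using f' by blast
    qed
    ultimately have vdL: "vertex_decomposable (matching_complex ?L)"
      using less.prems(1) ne clique by (intro less.hyps[of ?L "{f' \<in> M. disjnt f' e}"]) auto
    have "matching ?D M" using M e(2) by (auto simp: matching_def)
    moreover have "card ?D < card E" using less.prems(1) e(1) by (rule card_Diff1_less)
    ultimately have vdD: "vertex_decomposable (matching_complex ?D)"
      using less.prems(1) ne cover clique by (intro less.hyps[of ?D M]) auto
    have "\<not> facet (matching_complex ?D) F" if F: "F \<in> matching_complex ?L" for F
    proof
      assume max: "facet (matching_complex ?D) F"
      have FL: "F \<subseteq> ?L" using F by (simp add: matching_complex_def matching_def)
      have fE: "f \<in> ?D" using f M e(2) by (auto simp: matching_def)
      \<comment> \<open>Since \<open>e\<close> meets \<open>f\<close>, a member of \<open>F\<close>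
        meeting \<open>f\<close> would meet \<open>e\<close> as well, but all members of
        \<open>F\<close> avoid \<open>e\<close>.\<close>
      have "disjnt g f" if "g \<in> F" for g
        using clique[of f g e] f fE e(1) FL that by auto
      then have "insert f F \<in> matching_complex ?D"
        using max fE by (simp add: matching_complex_def matching_insert facet_def)
      then have "insert f F = F" using max unfolding facet_def by blast
      \<comment> \<open>\<open>f\<close> meets \<open>e\<close>, so it cannot already lie in
        \<open>F\<close>.\<close>
      then show False using f FL disjnt_sym by blast
    qed
    moreover have "{e} \<in> matching_complex E"
      using e(1) by (simp add: matching_complex_def matching_def)
    ultimately have "shedding_vertex (matching_complex E) e"
      using link_matching_complex[OF e(1) e0]
      by (auto simp: shedding_vertex_def deletion_matching_complex)
    moreover have "matching_complex E \<noteq> {}"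
      using \<open>{e} \<in> matching_complex E\<close> by blast
    ultimately show ?thesis
      using vdL vdD simplicial_complex_matching_complex[OF less.prems(1)]
        vertex_decomposable.shed[of "matching_complex E" e]
      by (simp add: link_matching_complex[OF e(1) e0] deletion_matching_complex)
  qed
qed

lemma card_le_matching_number:
  "finite E \<Longrightarrow> matching E M \<Longrightarrow> card M \<le> matching_number E"
  unfolding matching_number_def by (intro Max_ge) (auto simp: finite_matchings)

lemma induced_matching_number_attained:
  assumes "finite E"
  obtains M where "induced_matching E M" "card M = induced_matching_number E"
proof -
  have "finite {M. induced_matching E M}"
    by (rule finite_subset[OF _ finite_matchings[OF assms]]) (auto simp: induced_matching_def)
  \<comment> \<open>The empty matching makes the set under \<open>Max\<close> nonempty, so that its
    maximum is attained.\<close>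
  moreover have "{} \<in> {M. induced_matching E M}"
    by (simp add: induced_matching_def matching_def)
  ultimately have "induced_matching_number E \<in> card ` {M. induced_matching E M}"
    unfolding induced_matching_number_def by (intro Max_in) auto
  then show thesis using that by auto
qed

theorem theorem3p3:
  fixes V :: "'v set" and E :: "'v set set"
  assumes "finite_simple_graph V E"
    and "E \<noteq> {}"
    and "induced_matching_number E = matching_number E"
  shows "vertex_decomposable (matching_complex E)"
proof -
  have "finite V" "E \<subseteq> nsets V 2"
    using assms(1) by (auto simp: finite_simple_graph_def)
  then have fin: "finite E"
    using finite_subset finite_imp_finite_nsets by metis
  have ne: "{} \<notin> E"
    using \<open>E \<subseteq> nsets V 2\<close> by (auto simp: nsets_def)
  obtain M where ind: "induced_matching E M" and card_M: "card M = matching_number E"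
    using induced_matching_number_attained[OF fin] assms(3) by metis
  then have M: "matching E M" by (simp add: induced_matching_def)
  then have finM: "finite M"
    using fin finite_subset by (auto simp: matching_def)
  \<comment> \<open>An edge meeting two members of \<open>M\<close> would be the connecting edge
    forbidden in an induced matching.\<close>
  have only: "disjnt e f'" if "e \<in> E" "f \<in> M" "f' \<in> M" "\<not> disjnt e f" "f' \<noteq> f" for e f f'
    using ind that unfolding induced_matching_def disjnt_def by blast
  show ?thesis
  proof (rule vertex_decomposable_clique_partition[OF fin ne M])
    fix e assume e: "e \<in> E"
    show "\<exists>f\<in>M. \<not> disjnt e f"
    \<comment> \<open>An edge disjoint from all of \<open>M\<close> could be added to
      \<open>M\<close>, exceeding the matching number.\<close>
    proof (rule ccontr)
      assume "\<not> ?thesis"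
      then have disj: "\<forall>f\<in>M. disjnt f e" using disjnt_sym by blast
      then have "e \<notin> M" using e ne by auto
      moreover have "matching E (insert e M)" using M e disj by (simp add: matching_insert)
      ultimately show False
        using card_le_matching_number[OF fin] card_M finM by fastforce
    qed
  next
    fix f e g
    assume *: "f \<in> M" "e \<in> E" "g \<in> E" "\<not> disjnt e f" "\<not> disjnt g f"
    show "\<not> disjnt e g"
    proof
      assume eg: "disjnt e g"
      let ?N = "insert e (insert g (M - {f}))"
      \<comment> \<open>Both \<open>e\<close> and \<open>g\<close> meet \<open>f\<close>, hence no
        other member of \<open>M\<close>.\<close>
      have disj: "disjnt h e" "disjnt h g" if "h \<in> M - {f}" for h
        using only[of e f h] only[of g f h] * that disjnt_sym by blast+
      have "e \<noteq> {}" "g \<noteq> {}" using * ne by auto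
      then have new: "e \<noteq> g" "e \<notin> M - {f}" "g \<notin> M - {f}"
        using eg disj by fastforce+
      have "matching E ?N"
        unfolding matching_insert
        using * eg disj disjnt_sym[OF eg] matching_subset[OF M, of "M - {f}"] disjnt_sym
        by (metis Diff_subset insertE)
      \<comment> \<open>One edge leaves \<open>M\<close> and two distinct new ones enter.\<close>
      moreover have "card ?N = Suc (card M)"
        using new finM card_Suc_Diff1[OF finM \<open>f \<in> M\<close>] by simp
      ultimately show False
        using card_le_matching_number[OF fin] card_M by fastforce
    qed
  qed
qed

end
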